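(* Let $G$ be a finite simple graph, let $\langle a,b:c,d\rangle$ be an alternating 4-cycle in $G$, and let $H$ be the graph obtained from $G$ by the 2-switch on $\langle a,b:c,d\rangle$. If $H$ is not isomorphic to $G$, then $G$ contains one of the configurations (a), (b), (c), (d) described below via an injection $f$ such that performing the 2-switch on $\langle f(p),f(q):f(r),f(s)\rangle$ in $G$ yields exactly $H$ (i.e. this 2-switch deletes and adds exactly the same edges as the 2-switch on $\langle a,b:c,d\rangle$).
   Context: All graphs are finite and simple. An alternating 4-cycle $\langle a,b:c,d\rangle$ in a graph $G$ consists of four distinct vertices with $ab,cd\in E(G)$ and $bc,ad\notin E(G)$; the 2-switch on it deletes $ab,cd$ and adds $bc,ad$. A configuration is a triple $(V,E,F)$ where $(V,E)$ is a graph and $F$ is a set of pairs of vertices of $V$ not in $E$ ("non-edges"). A graph $G$ contains the configuration $(V,E,F)$ (on the vertex set $W$) if there is a bijection $f:V\to W\subseteq V(G)$ such that $f(x)f(y)\in E(G)$ for every $xy\in E$ and $f(x)f(y)\notin E(G)$ for every $xy\in F$; pairs in neither $E$ nor $F$ are unconstrained. The four configurations are: (a) vertices $p,q,r,s,w$; edges $pq,rs,qw,rw$; non-edges $qr,ps,pw,sw$. (b) vertices $p,q,r,s,w$; edges $pq,rs,pw,qw$; non-edges $qr,ps,rw,sw$. (c) vertices $p,q,r,s,y,z$; edges $pq,rs,pz,qy$; non-edges $qr,ps,rz,sy$. (d) vertices $p,q,r,s,y,z$; edges $pq,rs,ry,qz$; non-edges $qr,ps,py,sz$. (In each, $\langle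 p,q:r,s\rangle$ is an alternating 4-cycle.) *)

theory Defs
  imports "HOL-Library.Ramsey"
begin

text \<open>Edges are two-element sets of vertices; \<^term>\<open>nsets V 2\<close> is the set of all of them.\<close>

record 'a ugraph =
  verts :: "'a set"
  edges :: "'a set set"

definition simple_graph :: "'a ugraph \<Rightarrow> bool" where
  "simple_graph G \<longleftrightarrow> finite (verts G) \<and> edges G \<subseteq> nsets (verts G) 2"

definition isomorphic :: "'a ugraph \<Rightarrow> 'b ugraph \<Rightarrow> bool" where
  "isomorphic G H \<longleftrightarrow>
     (\<exists>\<phi>. bij_betw \<phi> (verts G) (verts H) \<and>
          (\<forall>x\<in>verts G. \<forall>y\<in>verts G. {x, y} \<in> edges G \<longleftrightarrow> {\<phi> x, \<phi> y} \<in> edges H))"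

definition alternating_4_cycle :: "'a ugraph \<Rightarrow> 'a \<Rightarrow> 'a \<Rightarrow> 'a \<Rightarrow> 'a \<Rightarrow> bool" where
  "alternating_4_cycle G a b c d \<longleftrightarrow>
     {a, b, c, d} \<subseteq> verts G \<and> distinct [a, b, c, d] \<and>
     {a, b} \<in> edges G \<and> {c, d} \<in> edges G \<and>
     {b, c} \<notin> edges G \<and> {a, d} \<notin> edges G"

definition two_switch :: "'a ugraph \<Rightarrow> 'a \<Rightarrow> 'a \<Rightarrow> 'a \<Rightarrow> 'a \<Rightarrow> 'a ugraph" where
  "two_switch G a b c d =
     \<lparr>verts = verts G, edges = (edges G - {{a, b}, {c, d}}) \<union> {{b, c}, {a, d}}\<rparr>"

record 'v configuration =
  cgraph :: "'v ugraph"
  nonedges :: "'v set set"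

definition wf_configuration :: "'v configuration \<Rightarrow> bool" where
  "wf_configuration C \<longleftrightarrow>
     simple_graph (cgraph C) \<and>
     nonedges C \<subseteq> nsets (verts (cgraph C)) 2 - edges (cgraph C)"

definition contains_via :: "'a ugraph \<Rightarrow> 'v configuration \<Rightarrow> ('v \<Rightarrow> 'a) \<Rightarrow> bool" where
  "contains_via G C f \<longleftrightarrow>
     inj_on f (verts (cgraph C)) \<and> f ` verts (cgraph C) \<subseteq> verts G \<and>
     (\<forall>x y. {x, y} \<in> edges (cgraph C) \<longrightarrow> {f x, f y} \<in> edges G) \<and>
     (\<forall>x y. {x, y} \<in> nonedges C \<longrightarrow> {f x, f y} \<notin> edges G)"

datatype cvertex = P | Q | R | S | W | Y | Z

definition config_a :: "cvertex configuration" where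
  "config_a =
     \<lparr>cgraph = \<lparr>verts = {P, Q, R, S, W}, edges = {{P, Q}, {R, S}, {Q, W}, {R, W}}\<rparr>,
      nonedges = {{Q, R}, {P, S}, {P, W}, {S, W}}\<rparr>"

definition config_b :: "cvertex configuration" where
  "config_b =
     \<lparr>cgraph = \<lparr>verts = {P, Q, R, S, W}, edges = {{P, Q}, {R, S}, {P, W}, {Q, W}}\<rparr>,
      nonedges = {{Q, R}, {P, S}, {R, W}, {S, W}}\<rparr>"

definition config_c :: "cvertex configuration" where
  "config_c =
     \<lparr>cgraph = \<lparr>verts = {P, Q, R, S, Y, Z}, edges = {{P, Q}, {R, S}, {P, Z}, {Q, Y}}\<rparr>,
      nonedges = {{Q, R}, {P, S}, {R, Z}, {S, Y}}\<rparr>"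

definition config_d :: "cvertex configuration" where
  "config_d =
     \<lparr>cgraph = \<lparr>verts = {P, Q, R, S, Y, Z}, edges = {{P, Q}, {R, S}, {R, Y}, {Q, Z}}\<rparr>,
      nonedges = {{Q, R}, {P, S}, {P, Y}, {S, Z}}\<rparr>"

lemmas config_defs = config_a_def config_b_def config_c_def config_d_def

lemma wf_configs:
  "wf_configuration config_a" "wf_configuration config_b"
  "wf_configuration config_c" "wf_configuration config_d"
  by (simp_all add: wf_configuration_def simple_graph_def nsets_def config_defs doubleton_eq_iff)

lemma contains_via_alternating_4_cycle:
  assumes "C \<in> {config_a, config_b, config_c, config_d}" and "contains_via G C f"
  shows "alternating_4_cycle G (f P) (f Q) (f R) (f S)"
proof -
  have C: "{P, Q, R, S} \<subseteq> verts (cgraph C)"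
    "{P, Q} \<in> edges (cgraph C)" "{R, S} \<in> edges (cgraph C)"
    "{Q, R} \<in> nonedges C" "{P, S} \<in> nonedges C"
    using assms(1) by (elim insertE emptyE; simp add: config_defs)+
  have "inj_on f {P, Q, R, S}"
    using assms(2) C(1) unfolding contains_via_def by (meson inj_on_subset)
  then have "distinct [f P, f Q, f R, f S]"
    by (simp add: inj_on_def)
  moreover have "{f P, f Q, f R, f S} \<subseteq> verts G"
    using assms(2) C(1) unfolding contains_via_def by blast
  ultimately show ?thesis
    using assms(2) C(2-) unfolding contains_via_def alternating_4_cycle_def by blast
qed

lemma simple_graph_two_switch:
  assumes "simple_graph G" and "alternating_4_cycle G a b c d"
  shows "simple_graph (two_switch G a b c d)"
  using assms by (auto simp: simple_graph_def alternating_4_cycle_def two_switch_def nsets_def)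

text \<open>Equality of the resulting graphs means that the same edges are deleted and added.\<close>

lemma two_switch_eq_iff:
  assumes "alternating_4_cycle G a b c d" and "alternating_4_cycle G p q r s"
  shows "two_switch G p q r s = two_switch G a b c d \<longleftrightarrow>
    {{p, q}, {r, s}} = {{a, b}, {c, d}} \<and> {{q, r}, {p, s}} = {{b, c}, {a, d}}"
proof -
  have *: "E - A \<union> B = E - A' \<union> B' \<longleftrightarrow> A = A' \<and> B = B'"
    if "A \<subseteq> E" "A' \<subseteq> E" "B \<inter> E = {}" "B' \<inter> E = {}" for E A A' B B' :: "'a set set"
    using that by blast
  have "two_switch G p q r s = two_switch G a b c d \<longleftrightarrow>
      edges G - {{p, q}, {r, s}} \<union> {{q, r}, {p, s}} =
      edges G - {{a, b}, {c, d}} \<union> {{b, c}, {a, d}}"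
    by (simp only: two_switch_def ugraph.ext_inject simp_thms)
  also have "\<dots> \<longleftrightarrow> {{p, q}, {r, s}} = {{a, b}, {c, d}} \<and> {{q, r}, {p, s}} = {{b, c}, {a, d}}"
    by (rule *) (use assms in \<open>simp_all add: alternating_4_cycle_def\<close>)
  finally show ?thesis .
qed

end

theory Submission
  imports Defs "HOL-Combinatorics.Transposition"
begin

text \<open>If every vertex outside the 4-cycle is adjacent to both or neither of \<open>a\<close> and \<open>c\<close>, then
  exchanging \<open>a\<close> and \<open>c\<close> is an isomorphism from \<open>H\<close> to \<open>G\<close>; likewise for \<open>b\<close> and \<open>d\<close>. Otherwise
  some outside vertex separates \<open>a\<close> from \<open>c\<close> and some outside vertex separates \<open>b\<close> from \<open>d\<close>. These
  two vertices give (c) or (d) if they are distinct and (a) or (b) if they coincide.\<close>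

lemma alternating_4_cycle_reflect:
  "alternating_4_cycle G b a d c \<longleftrightarrow> alternating_4_cycle G a b c d"
  unfolding alternating_4_cycle_def by (auto simp: insert_commute)

lemma alternating_4_cycle_rotate:
  "alternating_4_cycle G c d a b \<longleftrightarrow> alternating_4_cycle G a b c d"
  unfolding alternating_4_cycle_def by (auto simp: insert_commute)

lemma two_switch_reflect: "two_switch G b a d c = two_switch G a b c d"
  by (auto simp: two_switch_def insert_commute)

lemma two_switch_rotate: "two_switch G c d a b = two_switch G a b c d"
  by (auto simp: two_switch_def insert_commute)

text \<open>\<open>transpose a c\<close> carries the added pairs \<open>{b, c}\<close>,
  \<open>{a, d}\<close> to the edges \<open>{a, b}\<close>, \<open>{c, d}\<close> of
  \<open>G\<close>, and the deleted pairs to non-edges of \<open>G\<close>.\<close>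

lemma isomorphic_two_switch_if_twins:
  assumes G: "simple_graph G"
    and alt: "alternating_4_cycle G a b c d"
    and twins: "\<And>v. v \<in> verts G - {a, b, c, d} \<Longrightarrow> {a, v} \<in> edges G \<longleftrightarrow> {c, v} \<in> edges G"
  shows "isomorphic (two_switch G a b c d) G"
proof -
  let ?\<phi> = "transpose a c"
  have loop: "{x} \<notin> edges G" for x
    using G by (auto simp: simple_graph_def nsets_def)
  have V: "a \<in> verts G" "c \<in> verts G"
    and dist: "a \<noteq> b" "a \<noteq> c" "a \<noteq> d" "b \<noteq> c" "b \<noteq> d" "c \<noteq> d"
    and E: "{a, b} \<in> edges G" "{c, d} \<in> edges G" "{b, c} \<notin> edges G" "{a, d} \<notin> edges G"
    using alt by (auto simp: alternating_4_cycle_def)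
  have "bij_betw ?\<phi> (verts G) (verts G)"
    using V by (simp add: bij_betw_def)
  moreover have "{x, y} \<in> edges (two_switch G a b c d) \<longleftrightarrow> {?\<phi> x, ?\<phi> y} \<in> edges G"
    if "x \<in> verts G" "y \<in> verts G" for x y
  proof -
    \<comment> \<open>For \<open>v\<close> in \<open>{b, d}\<close> the alternating 4-cycle decides,
      for \<open>v\<close> in \<open>{a, c}\<close> the pair is a loop or \<open>{a, c}\<close>
      itself, and otherwise \<open>twins\<close> applies.\<close>
    have a: "{a, v} \<in> edges (two_switch G a b c d) \<longleftrightarrow> {c, ?\<phi> v} \<in> edges G"
      and c: "{c, v} \<in> edges (two_switch G a b c d) \<longleftrightarrow> {a, ?\<phi> v} \<in> edges G"
      if "v \<in> verts G" for v
      using that E dist loop twins[of v]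
      by (cases "v \<in> {a, b, c, d}";
          auto simp: two_switch_def transpose_def doubleton_eq_iff insert_commute)+
    show ?thesis
    proof (cases "x \<in> {a, c} \<or> y \<in> {a, c}")
      case True
      then show ?thesis
        using a[of x] a[of y] c[of x] c[of y] that by (auto simp: insert_commute)
    next
      \<comment> \<open>Every switched pair meets \<open>{a, c}\<close>, so this pair is untouched
        by the switch and fixed by the transposition.\<close>
      case False
      then show ?thesis
        by (auto simp: two_switch_def doubleton_eq_iff)
    qed
  qed
  ultimately show ?thesis
    unfolding isomorphic_def by (auto simp: two_switch_def)
qed

text \<open>Configuration (b) is (c) with \<open>Y\<close> and \<open>Z\<close> merged into
  \<open>W\<close>; likewise, (a) arises from (d).\<close>

lemma contains_b_or_c:
  assumes alt: "alternating_4_cycle G p q r s"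
    and z: "z \<in> verts G - {p, q, r, s}" "{p, z} \<in> edges G" "{r, z} \<notin> edges G"
    and y: "y \<in> verts G - {p, q, r, s}" "{q, y} \<in> edges G" "{s, y} \<notin> edges G"
  shows "\<exists>C \<in> {config_b, config_c}. \<exists>f. contains_via G C f \<and> f P = p \<and> f Q = q \<and> f R = r \<and> f S = s"
proof -
  \<comment> \<open>One map serves both configurations: \<open>W\<close> occurs only in
    \<open>config_b\<close>, where \<open>y = z\<close>.\<close>
  define f where "f = (\<lambda>v. case v of P \<Rightarrow> p | Q \<Rightarrow> q | R \<Rightarrow> r | S \<Rightarrow> s | W \<Rightarrow> z | Y \<Rightarrow> y | Z \<Rightarrow> z)"
  have "contains_via G config_b f" if "y = z"
    using assms that unfolding contains_via_def alternating_4_cycle_def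
    by (auto simp: config_b_def f_def doubleton_eq_iff insert_commute)
  moreover have "contains_via G config_c f" if "y \<noteq> z"
    using assms that unfolding contains_via_def alternating_4_cycle_def
    by (auto simp: config_c_def f_def doubleton_eq_iff insert_commute)
  ultimately have "\<exists>C \<in> {config_b, config_c}. contains_via G C f"
    by blast
  then show ?thesis
    by (fastforce simp: f_def)
qed

lemma contains_a_or_d:
  assumes alt: "alternating_4_cycle G p q r s"
    and y: "y \<in> verts G - {p, q, r, s}" "{r, y} \<in> edges G" "{p, y} \<notin> edges G"
    and z: "z \<in> verts G - {p, q, r, s}" "{q, z} \<in> edges G" "{s, z} \<notin> edges G"
  shows "\<exists>C \<in> {config_a, config_d}. \<exists>f. contains_via G C f \<and> f P = p \<and> f Q = q \<and> f R = r \<and> f S = s"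
proof -
  define f where "f = (\<lambda>v. case v of P \<Rightarrow> p | Q \<Rightarrow> q | R \<Rightarrow> r | S \<Rightarrow> s | W \<Rightarrow> z | Y \<Rightarrow> y | Z \<Rightarrow> z)"
  have "contains_via G config_a f" if "y = z"
    using assms that unfolding contains_via_def alternating_4_cycle_def
    by (auto simp: config_a_def f_def doubleton_eq_iff insert_commute)
  moreover have "contains_via G config_d f" if "y \<noteq> z"
    using assms that unfolding contains_via_def alternating_4_cycle_def
    by (auto simp: config_d_def f_def doubleton_eq_iff insert_commute)
  ultimately have "\<exists>C \<in> {config_a, config_d}. contains_via G C f"
    by blast
  then show ?thesis
    by (fastforce simp: f_def)
qed

text \<open>With \<open>y\<close> attached to \<open>q\<close>, the type depends on the neighbour of
  \<open>x\<close>: (b) or (c) for \<open>p\<close>, (a) or (d) for \<open>r\<close>.\<close>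

lemma contains_config_if_separated:
  assumes alt: "alternating_4_cycle G p q r s"
    and x: "x \<in> verts G - {p, q, r, s}" "{p, x} \<in> edges G \<longleftrightarrow> {r, x} \<notin> edges G"
    and y: "y \<in> verts G - {p, q, r, s}" "{q, y} \<in> edges G" "{s, y} \<notin> edges G"
  shows "\<exists>C \<in> {config_a, config_b, config_c, config_d}.
           \<exists>f. contains_via G C f \<and> two_switch G (f P) (f Q) (f R) (f S) = two_switch G p q r s"
proof (cases "{p, x} \<in> edges G")
  case True
  then show ?thesis
    using contains_b_or_c[OF alt x(1) _ _ y] x(2) by fastforce
next
  case False
  then show ?thesis
    using contains_a_or_d[OF alt x(1) _ _ y] x(2) by fastforce
qed

theorem theorem2p2:
  fixes G H :: "'a ugraph" and a b c d :: 'a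
  assumes "simple_graph G"
    and "alternating_4_cycle G a b c d"
    and "H = two_switch G a b c d"
    and "\<not> isomorphic H G"
  shows "\<exists>C \<in> {config_a, config_b, config_c, config_d}.
           \<exists>f. contains_via G C f \<and> two_switch G (f P) (f Q) (f R) (f S) = H"
proof -
  obtain x where x: "x \<in> verts G - {a, b, c, d}" "{a, x} \<in> edges G \<longleftrightarrow> {c, x} \<notin> edges G"
    using isomorphic_two_switch_if_twins[of G a b c d] assms by blast
  \<comment> \<open>Reading the same switch from \<open>b\<close> turns \<open>b\<close>,
    \<open>d\<close> into the pair to be exchanged.\<close>
  obtain y where y: "y \<in> verts G - {b, a, d, c}" "{b, y} \<in> edges G \<longleftrightarrow> {d, y} \<notin> edges G"
    using isomorphic_two_switch_if_twins[of G b a d c] assms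
    by (auto simp: alternating_4_cycle_reflect two_switch_reflect)
  show ?thesis
  proof (cases "{b, y} \<in> edges G")
    case True
    then show ?thesis
      using contains_config_if_separated[of G a b c d x y] assms(2,3) x y
      by (simp add: insert_commute)
  next
    case False
    \<comment> \<open>Now \<open>y\<close> is adjacent to \<open>d\<close>. Starting the cycle at
      \<open>c\<close> puts \<open>d\<close> in the role of \<open>q\<close>, while the condition on
      \<open>x\<close> is symmetric in \<open>a\<close> and \<open>c\<close>.\<close>
    then have "\<exists>C \<in> {config_a, config_b, config_c, config_d}.
        \<exists>f. contains_via G C f \<and> two_switch G (f P) (f Q) (f R) (f S) = two_switch G c d a b"
      using assms(2) x y
      by (intro contains_config_if_separated[of G c d a b x y])
        (auto simp: alternating_4_cycle_rotate)
    then show ?thesis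
      by (simp only: two_switch_rotate assms(3))
  qed
qed

end
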